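(* For every integer $n\geqslant 5$, the graph $D_n$ is $d$-balanced, i.e. $\gamma_{bd}(D_n)=0$.
   Context: For a simple undirected finite graph $G$ and $v\in V(G)$, the closed neighborhood is $N_G[v]=\{u\in V(G): uv\in E(G)\}\cup\{v\}$. A function $f\colon V(G)\to\{-1,0,1\}$ is a balanced domination function (BDF) on $G$ if $\sum_{u\in N_G[v]} f(u)=0$ for every $v\in V(G)$. Its weight is $\omega_f=\sum_{v\in V(G)} f(v)$. The balanced domination number $\gamma_{bd}(G)$ is the maximum of $\omega_f$ over all BDFs $f$ on $G$. The graph $G$ is called $d$-balanced if $\gamma_{bd}(G)=0$. For $n\geqslant 5$, the convex polytope graph $D_n$ is the simple undirected graph with vertex set $V(D_n)=\{u_i,v_i,w_i,q_i \mid 0\leqslant i\leqslant n-1\}$ ($4n$ distinct vertices) and edge set $E(D_n)=\{u_iu_{i+1},\ q_iq_{i+1},\ u_iv_i,\ v_iw_i,\ v_{i+1}w_i,\ w_iq_i \mid 0\leqslant i\leqslant n-1\}$, where indices are taken modulo $n$. *)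

theory Defs
  imports "Graph_Theory.Pair_Digraph"
begin

text \<open>
  Finite simple undirected graphs are rendered by the locale \<open>pair_graph\<close>: an edge \<open>xy\<close>
  is the pair of arcs \<open>(x, y)\<close> and \<open>(y, x)\<close>.
\<close>

definition closed_neighborhood :: "'a pair_pre_digraph \<Rightarrow> 'a \<Rightarrow> 'a set" where
  "closed_neighborhood G v = {u \<in> pverts G. (u, v) \<in> parcs G} \<union> {v}"

text \<open>
  A function on the vertex set is a total function whose values outside \<open>pverts G\<close> are
  unconstrained and never used.
\<close>

definition BDF :: "'a pair_pre_digraph \<Rightarrow> ('a \<Rightarrow> int) \<Rightarrow> bool" where
  "BDF G f \<longleftrightarrow> (\<forall>v \<in> pverts G. f v \<in> {-1, 0, 1}) \<and>
     (\<forall>v \<in> pverts G. (\<Sum>u \<in> closed_neighborhood G v. f u) = 0)"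

definition weight :: "'a pair_pre_digraph \<Rightarrow> ('a \<Rightarrow> int) \<Rightarrow> int" where
  "weight G f = (\<Sum>v \<in> pverts G. f v)"

definition balanced_domination_number :: "'a pair_pre_digraph \<Rightarrow> int" where
  "balanced_domination_number G = Max {weight G f | f. BDF G f}"

definition d_balanced :: "'a pair_pre_digraph \<Rightarrow> bool" where
  "d_balanced G \<longleftrightarrow> balanced_domination_number G = 0"

text \<open>The maximum is taken over a finite nonempty set, so \<open>Max\<close> is the actual maximum.\<close>

lemma BDF_zero: "BDF G (\<lambda>_. 0)"
  by (simp add: BDF_def)

lemma weight_bound:
  assumes "BDF G f"
  shows "\<bar>weight G f\<bar> \<le> int (card (pverts G))"
proof -
  have "\<bar>weight G f\<bar> \<le> (\<Sum>v \<in> pverts G. \<bar>f v\<bar>)"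
    unfolding weight_def by (rule sum_abs)
  also have "\<dots> \<le> (\<Sum>v \<in> pverts G. 1)"
    using assms by (intro sum_mono) (auto simp: BDF_def)
  finally show ?thesis by simp
qed

lemma finite_weights: "finite {weight G f | f. BDF G f}"
proof (rule finite_subset)
  show "{weight G f | f. BDF G f} \<subseteq> {- int (card (pverts G)) .. int (card (pverts G))}"
    using weight_bound abs_le_iff by fastforce
qed simp

lemma weights_nonempty: "{weight G f | f. BDF G f} \<noteq> {}"
  using BDF_zero by blast

datatype polytope_vertex = Vu nat | Vv nat | Vw nat | Vq nat

definition D_edges :: "nat \<Rightarrow> (polytope_vertex \<times> polytope_vertex) set" where
  "D_edges n = (\<Union>i \<in> {..<n}.
     {(Vu i, Vu ((i + 1) mod n)), (Vq i, Vq ((i + 1) mod n)),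
      (Vu i, Vv i), (Vv i, Vw i), (Vv ((i + 1) mod n), Vw i), (Vw i, Vq i)})"

definition D_graph :: "nat \<Rightarrow> polytope_vertex pair_pre_digraph" where
  "D_graph n = \<lparr> pverts = (\<Union>i \<in> {..<n}. {Vu i, Vv i, Vw i, Vq i}),
                 parcs = D_edges n \<union> (D_edges n)\<inverse> \<rparr>"

lemma pair_graph_D_graph:
  assumes "n \<ge> 5"
  shows "pair_graph (D_graph n)"
proof -
  have ne: "Suc i mod n \<noteq> i" if "i < n" for i
    using that assms by (cases "Suc i = n") auto
  have pos: "0 < n"
    using assms by simp
  have fin: "finite (D_edges n)"
    by (simp add: D_edges_def)
  have loop: "(x, x) \<notin> D_edges n" for x
    using ne by (cases x) (auto simp: D_edges_def eq_commute)
  show ?thesis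
  proof
    show "finite (parcs (D_graph n))"
      using fin by (simp add: D_graph_def)
    show "symmetric (with_proj (D_graph n))"
      by (auto simp: symmetric_def D_graph_def sym_def)
    show "fst e \<noteq> snd e" if "e \<in> parcs (D_graph n)" for e
      using that loop by (cases e) (auto simp: D_graph_def)
  qed (use pos in \<open>auto simp: D_graph_def D_edges_def\<close>)
qed

lemma card_verts_D_graph: "card (pverts (D_graph n)) = 4 * n"
proof -
  have "pverts (D_graph n) = Vu ` {..<n} \<union> (Vv ` {..<n} \<union> (Vw ` {..<n} \<union> Vq ` {..<n}))"
    by (auto simp: D_graph_def)
  moreover have "card \<dots> = 4 * n"
    by (subst card_Un_disjoint; (force simp: card_image inj_on_def)?)+
  ultimately show ?thesis by simp
qed

end

theory Submission
  imports Defs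
begin

text \<open>
  Adding up the defining equations of a BDF over each of the four orbits of vertices shows that
  the orbit sums \<open>U, V, W, Q\<close> satisfy \<open>3U + V = U + V + 2W = 2V + W + Q = W + 3Q = 0\<close>.
  This linear system is nonsingular, so every BDF of \<open>D_n\<close> has weight \<open>0\<close>.
\<close>

text \<open>Case distinctions instead of \<open>mod\<close> reduce facts about cyclic indices to
  linear arithmetic.\<close>

definition cyc_succ :: "nat \<Rightarrow> nat \<Rightarrow> nat" where
  "cyc_succ n i = (if Suc i = n then 0 else Suc i)"

definition cyc_pred :: "nat \<Rightarrow> nat \<Rightarrow> nat" where
  "cyc_pred n i = (if i = 0 then n - 1 else i - 1)"

lemma Suc_mod_eq_cyc_succ: "i < n \<Longrightarrow> Suc i mod n = cyc_succ n i"
  by (auto simp: cyc_succ_def)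

lemma cyc_succ_less: "i < n \<Longrightarrow> cyc_succ n i < n"
  by (auto simp: cyc_succ_def)

lemma cyc_pred_less: "i < n \<Longrightarrow> cyc_pred n i < n"
  by (auto simp: cyc_pred_def)

text \<open>For an edge of \<open>D_edges\<close> met at its shifted endpoint, this solves for the
  base index; that is how predecessors enter the neighborhoods.\<close>

lemma cyc_succ_eq_iff: "i < n \<Longrightarrow> j < n \<Longrightarrow> i = cyc_succ n j \<longleftrightarrow> j = cyc_pred n i"
  by (auto simp: cyc_succ_def cyc_pred_def)

text \<open>On a cycle of length at least 3 the two neighbors of a vertex differ. Hence the
  neighborhoods below have four distinct elements and their sums split into four terms.\<close>

lemma cyc_distinct:
  assumes "i < n" "3 \<le> n"
  shows "cyc_succ n i \<noteq> i" "cyc_pred n i \<noteq> i" "cyc_succ n i \<noteq> cyc_pred n i"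
  using assms by (auto simp: cyc_succ_def cyc_pred_def)

lemma bij_betw_cyc_succ: "bij_betw (cyc_succ n) {..<n} {..<n}"
  by (rule bij_betw_byWitness[where f' = "cyc_pred n"])
     (auto simp: cyc_succ_def cyc_pred_def)

lemma bij_betw_cyc_pred: "bij_betw (cyc_pred n) {..<n} {..<n}"
  by (rule bij_betw_byWitness[where f' = "cyc_succ n"])
     (auto simp: cyc_succ_def cyc_pred_def)

text \<open>Rotating an orbit permutes it, so shifted terms contribute the same orbit sum as
  unshifted ones.\<close>

lemma sum_cyc_succ: "(\<Sum>i<n. g (cyc_succ n i)) = (\<Sum>i<n. g i)"
  by (rule sum.reindex_bij_betw[OF bij_betw_cyc_succ])

lemma sum_cyc_pred: "(\<Sum>i<n. g (cyc_pred n i)) = (\<Sum>i<n. g i)"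
  by (rule sum.reindex_bij_betw[OF bij_betw_cyc_pred])

lemma D_edges_cyc_succ:
  "D_edges n = (\<Union>i \<in> {..<n}.
     {(Vu i, Vu (cyc_succ n i)), (Vq i, Vq (cyc_succ n i)),
      (Vu i, Vv i), (Vv i, Vw i), (Vv (cyc_succ n i), Vw i), (Vw i, Vq i)})"
  unfolding D_edges_def by (rule SUP_cong) (auto simp: Suc_mod_eq_cyc_succ)

lemma closed_neighborhood_D_graph:
  assumes "i < n"
  shows "closed_neighborhood (D_graph n) (Vu i) =
           {Vu i, Vu (cyc_succ n i), Vu (cyc_pred n i), Vv i}"
    and "closed_neighborhood (D_graph n) (Vv i) = {Vv i, Vu i, Vw i, Vw (cyc_pred n i)}"
    and "closed_neighborhood (D_graph n) (Vw i) = {Vw i, Vv i, Vv (cyc_succ n i), Vq i}"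
    and "closed_neighborhood (D_graph n) (Vq i) =
           {Vq i, Vq (cyc_succ n i), Vq (cyc_pred n i), Vw i}"
  using assms
  by (auto simp: closed_neighborhood_def D_graph_def D_edges_cyc_succ
        cyc_succ_less cyc_pred_less cyc_succ_eq_iff)

lemma BDF_D_graph_equations:
  assumes "BDF (D_graph n) f" "3 \<le> n" "i < n"
  shows "f (Vu i) + f (Vu (cyc_succ n i)) + f (Vu (cyc_pred n i)) + f (Vv i) = 0"
    and "f (Vv i) + f (Vu i) + f (Vw i) + f (Vw (cyc_pred n i)) = 0"
    and "f (Vw i) + f (Vv i) + f (Vv (cyc_succ n i)) + f (Vq i) = 0"
    and "f (Vq i) + f (Vq (cyc_succ n i)) + f (Vq (cyc_pred n i)) + f (Vw i) = 0"
proof -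
  have eq: "(\<Sum>u \<in> closed_neighborhood (D_graph n) x. f u) = 0"
    if "x \<in> {Vu i, Vv i, Vw i, Vq i}" for x
    using assms that by (auto simp: BDF_def D_graph_def)
  \<comment> \<open>Both orientations are supplied because the membership tests in a sum over an
    explicit set may produce either one.\<close>
  note d = cyc_distinct[OF assms(3,2)] cyc_distinct[OF assms(3,2), symmetric]
  show "f (Vu i) + f (Vu (cyc_succ n i)) + f (Vu (cyc_pred n i)) + f (Vv i) = 0"
    using eq[of "Vu i"] d by (simp add: closed_neighborhood_D_graph[OF assms(3)])
  show "f (Vv i) + f (Vu i) + f (Vw i) + f (Vw (cyc_pred n i)) = 0"
    using eq[of "Vv i"] d by (simp add: closed_neighborhood_D_graph[OF assms(3)])
  show "f (Vw i) + f (Vv i) + f (Vv (cyc_succ n i)) + f (Vq i) = 0"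
    using eq[of "Vw i"] d by (simp add: closed_neighborhood_D_graph[OF assms(3)])
  show "f (Vq i) + f (Vq (cyc_succ n i)) + f (Vq (cyc_pred n i)) + f (Vw i) = 0"
    using eq[of "Vq i"] d by (simp add: closed_neighborhood_D_graph[OF assms(3)])
qed

lemma weight_D_graph:
  "weight (D_graph n) f =
     (\<Sum>i<n. f (Vu i)) + (\<Sum>i<n. f (Vv i)) + (\<Sum>i<n. f (Vw i)) + (\<Sum>i<n. f (Vq i))"
proof -
  have "weight (D_graph n) f = (\<Sum>i<n. \<Sum>x \<in> {Vu i, Vv i, Vw i, Vq i}. f x)"
    unfolding weight_def D_graph_def by (simp add: sum.UNION_disjoint)
  then show ?thesis
    by (simp add: sum.distrib)
qed

lemma weight_BDF_D_graph:
  assumes "BDF (D_graph n) f" "3 \<le> n"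
  shows "weight (D_graph n) f = 0"
proof -
  let ?U = "\<Sum>i<n. f (Vu i)" and ?V = "\<Sum>i<n. f (Vv i)"
  let ?W = "\<Sum>i<n. f (Vw i)" and ?Q = "\<Sum>i<n. f (Vq i)"
  note eqs = BDF_D_graph_equations[OF assms]
  \<comment> \<open>The instantiation fixes the outer \<open>f\<close> and leaves the vertex
    constructor schematic, so one rule serves all four orbits.\<close>
  note sums = sum.distrib sum_cyc_succ[where g = "\<lambda>i. f (_ i)"] sum_cyc_pred[where g = "\<lambda>i. f (_ i)"]
  have "(\<Sum>i<n. f (Vu i) + f (Vu (cyc_succ n i)) + f (Vu (cyc_pred n i)) + f (Vv i)) = 0"
    by (rule sum.neutral) (simp add: eqs)
  then have "?U + ?U + ?U + ?V = 0"
    by (simp only: sums)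
  moreover have "(\<Sum>i<n. f (Vv i) + f (Vu i) + f (Vw i) + f (Vw (cyc_pred n i))) = 0"
    by (rule sum.neutral) (simp add: eqs)
  then have "?V + ?U + ?W + ?W = 0"
    by (simp only: sums)
  moreover have "(\<Sum>i<n. f (Vw i) + f (Vv i) + f (Vv (cyc_succ n i)) + f (Vq i)) = 0"
    by (rule sum.neutral) (simp add: eqs)
  then have "?W + ?V + ?V + ?Q = 0"
    by (simp only: sums)
  moreover have "(\<Sum>i<n. f (Vq i) + f (Vq (cyc_succ n i)) + f (Vq (cyc_pred n i)) + f (Vw i)) = 0"
    by (rule sum.neutral) (simp add: eqs)
  then have "?Q + ?Q + ?Q + ?W = 0"
    by (simp only: sums)
  ultimately show ?thesis
    \<comment> \<open>Elimination gives V = -3U, W = U and Q = 5U; the last equation becomes 16U =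
      0.\<close>
    unfolding weight_D_graph by linarith
qed

theorem theorem2:
  fixes n :: nat
  assumes "n \<ge> 5"
  shows "d_balanced (D_graph n)"
proof -
  have "weight (D_graph n) f = 0" if "BDF (D_graph n) f" for f
    using weight_BDF_D_graph[OF that] assms by simp
  \<comment> \<open>Nonemptiness, witnessed by the zero function, excludes the empty set, so
    \<open>Max\<close> is taken over exactly {0}.\<close>
  then have "{weight (D_graph n) f | f. BDF (D_graph n) f} = {0}"
    using weights_nonempty by fastforce
  then show ?thesis
    by (simp add: d_balanced_def balanced_domination_number_def)
qed

end
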